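(* Let $\mathcal H$ and $\mathcal G$ be real Hilbert spaces, let $\mathcal K=\mathcal H\oplus\mathcal G$, let $A\colon\mathcal H\to 2^{\mathcal H}$ and $B\colon\mathcal G\to 2^{\mathcal G}$ be maximally monotone, let $L\colon\mathcal H\to\mathcal G$ be a bounded linear operator, and let $(x_0,v_0^* )\in\mathcal K$. Assume that there exists $x\in\mathcal H$ such that $0\in Ax+L^*BLx$. Let $$Z=\{(x,v^* )\in\mathcal K : -L^*v^*\in Ax\ \text{and}\ Lx\in B^{-1}v^*\}$$ and let $(\overline x,\overline v^* )$ be the projection of $(x_0,v_0^* )$ onto $Z$. Let $\varepsilon\in\,]0,1[$, let $\alpha\in\,]0,+\infty[$, and for every $(x,v^* )\in\mathcal K$ let $G_\alpha(x,v^* )$ be the set of all $(a,b,a^*,b^* )\in\mathcal K\times\mathcal K$ such that $(a,a^* )\in\operatorname{gra}A$, $(b,b^* )\in\operatorname{gra}B$, and $$\langle x-a\mid a^*+L^*v^*\rangle+\langle Lx-b\mid b^*-v^*\rangle\geq\alpha\big(\|a^*+L^*b^*\|^2+\|La-b\|^2\big).$$ Iterate for $n=0,1,\ldots$: 1. Take any $(a_n,b_n,a_n^*,b_n^* )\in G_\alpha(x_n,v_n^* )$; set $s_n^*=a_n^*+L^*b_n^*$, $t_n=b_n-La_n$, $\tau_n=\|s_n^*\|^2+\|t_n\|^2$. 2. If $\tau_n=0$, set $\theta_n=0$. If $\tau_n>0$, take any $\lambda_n\in[\varepsilon,1]$ and set $\theta_n=\lambda_n\big(\langle x_n\mid s_n^*\rangle+\langle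 t_n\mid v_n^*\rangle-\langle a_n\mid a_n^*\rangle-\langle b_n\mid b_n^*\rangle\big)/\tau_n$. 3. Set $x_{n+1/2}=x_n-\theta_ns_n^*$ and $v_{n+1/2}^*=v_n^*-\theta_nt_n$. 4. Set $\chi_n=\langle x_0-x_n\mid x_n-x_{n+1/2}\rangle+\langle v_0^*-v_n^*\mid v_n^*-v_{n+1/2}^*\rangle$, $\mu_n=\|x_0-x_n\|^2+\|v_0^*-v_n^*\|^2$, $\nu_n=\|x_n-x_{n+1/2}\|^2+\|v_n^*-v_{n+1/2}^*\|^2$, $\rho_n=\mu_n\nu_n-\chi_n^2$. 5. If $\rho_n=0$ and $\chi_n\geq0$, set $x_{n+1}=x_{n+1/2}$ and $v_{n+1}^*=v_{n+1/2}^*$. If $\rho_n>0$ and $\chi_n\nu_n\geq\rho_n$, set $x_{n+1}=x_0+(1+\chi_n/\nu_n)(x_{n+1/2}-x_n)$ and $v_{n+1}^*=v_0^*+(1+\chi_n/\nu_n)(v_{n+1/2}^*-v_n^* )$. If $\rho_n>0$ and $\chi_n\nu_n<\rho_n$, set $x_{n+1}=x_n+(\nu_n/\rho_n)\big(\chi_n(x_0-x_n)+\mu_n(x_{n+1/2}-x_n)\big)$ and $v_{n+1}^*=v_n^*+(\nu_n/\rho_n)\big(\chi_n(v_0^*-v_n^* )+\mu_n(v_{n+1/2}^*-v_n^* )\big)$. Then this algorithm generates infinite sequences $(x_n)_{n\in\mathbb N}$ and $(v_n^* )_{n\in\mathbb N}$ (that is, at every iteration one of the three cases of step 5 applies), and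 the following hold: (i) $\sum_{n\in\mathbb N}\|x_{n+1}-x_n\|^2<+\infty$ and $\sum_{n\in\mathbb N}\|v_{n+1}^*-v_n^*\|^2<+\infty$. (ii) $\sum_{n\in\mathbb N}\|s_n^*\|^2<+\infty$ and $\sum_{n\in\mathbb N}\|t_n\|^2<+\infty$. (iii) Suppose that $x_n-a_n\rightharpoonup0$ and $v_n^*-b_n^*\rightharpoonup0$. Then $x_n\to\overline x$ and $v_n^*\to\overline v^*$.
   Context: $\mathcal H\oplus\mathcal G$ is the Hilbert direct sum. For a set-valued operator $A\colon\mathcal H\to2^{\mathcal H}$, $\operatorname{gra}A=\{(x,u): u\in Ax\}$ and $A^{-1}$ is the set-valued inverse ($x\in A^{-1}u\Leftrightarrow u\in Ax$). $A$ is monotone if $\langle x-y\mid u-v\rangle\geq0$ for all $(x,u),(y,v)\in\operatorname{gra}A$, and maximally monotone if moreover its graph is not properly contained in the graph of another monotone operator. $L^*$ is the adjoint of $L$, and $L^*BLx=\{L^*v : v\in B(Lx)\}$. The set $Z$ (Kuhn-Tucker set) is known to be nonempty, closed and convex under the stated assumptions, so the projection $(\overline x,\overline v^* )$ is well defined. $\rightharpoonup$ and $\to$ denote weak and strong convergence. *)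

theory Defs
  imports "HOL-Analysis.Analysis"
begin

text \<open>
  Real Hilbert spaces are types of class \<open>real_inner\<close> and \<open>complete_space\<close>. The Hilbert direct
  sum of two of them is the product type, whose library inner product is
  \<open>(x, v) \<bullet> (y, w) = x \<bullet> y + v \<bullet> w\<close>.
\<close>

definition gra :: "('a \<Rightarrow> 'b set) \<Rightarrow> ('a \<times> 'b) set" where
  "gra A = {(x, u). u \<in> A x}"

definition set_valued_inverse :: "('a \<Rightarrow> 'b set) \<Rightarrow> 'b \<Rightarrow> 'a set" where
  "set_valued_inverse A u = {x. u \<in> A x}"

definition monotone_operator :: "('a::real_inner \<Rightarrow> 'a set) \<Rightarrow> bool" where
  "monotone_operator A \<longleftrightarrow>
     (\<forall>x u y v. (x, u) \<in> gra A \<longrightarrow> (y, v) \<in> gra A \<longrightarrow> (x - y) \<bullet> (u - v) \<ge> 0)"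

definition maximally_monotone :: "('a::real_inner \<Rightarrow> 'a set) \<Rightarrow> bool" where
  "maximally_monotone A \<longleftrightarrow>
     monotone_operator A \<and> (\<nexists>C. monotone_operator C \<and> gra A \<subset> gra C)"

definition weakly_converges :: "(nat \<Rightarrow> 'a::real_inner) \<Rightarrow> 'a \<Rightarrow> bool" where
  "weakly_converges X l \<longleftrightarrow> (\<forall>y. (\<lambda>n. X n \<bullet> y) \<longlonglongrightarrow> l \<bullet> y)"

text \<open>
  The library's \<open>closest_point\<close> is restricted to \<open>heine_borel\<close> spaces, i.e. to finite dimension.
\<close>

definition projection_onto :: "'a::metric_space set \<Rightarrow> 'a \<Rightarrow> 'a" where
  "projection_onto S p = (THE q. q \<in> S \<and> (\<forall>r\<in>S. dist p q \<le> dist p r))"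

definition kuhn_tucker ::
  "('h::real_inner \<Rightarrow> 'h set) \<Rightarrow> ('g::real_inner \<Rightarrow> 'g set) \<Rightarrow> ('h \<Rightarrow> 'g) \<Rightarrow> ('h \<times> 'g) set" where
  "kuhn_tucker A B L =
     {(x, v). - adjoint L v \<in> A x \<and> L x \<in> set_valued_inverse B v}"

definition G_set ::
  "('h::real_inner \<Rightarrow> 'h set) \<Rightarrow> ('g::real_inner \<Rightarrow> 'g set) \<Rightarrow> ('h \<Rightarrow> 'g) \<Rightarrow> real
     \<Rightarrow> 'h \<times> 'g \<Rightarrow> (('h \<times> 'g) \<times> ('h \<times> 'g)) set" where
  "G_set A B L \<alpha> = (\<lambda>(x, v).
     {((a, b), (a', b')).
        (a, a') \<in> gra A \<and> (b, b') \<in> gra B \<and>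
        (x - a) \<bullet> (a' + adjoint L v) + (L x - b) \<bullet> (b' - v)
          \<ge> \<alpha> * ((norm (a' + adjoint L b'))\<^sup>2 + (norm (L a - b))\<^sup>2)})"

text \<open>
  A point of the direct sum is \<open>p = (x\<^sub>n, v\<^sub>n\<^sup>*)\<close>, the choice made in the first
  step is \<open>c = ((a\<^sub>n, b\<^sub>n), (a\<^sub>n\<^sup>*, b\<^sub>n\<^sup>*))\<close>, and \<open>l\<close> is the relaxation parameter, which has no
  influence when \<open>\<tau>\<^sub>n = 0\<close>.
\<close>

definition s_star ::
  "('h::real_inner \<Rightarrow> 'g::real_inner) \<Rightarrow> ('h \<times> 'g) \<times> ('h \<times> 'g) \<Rightarrow> 'h" where
  "s_star L = (\<lambda>((a, b), (a', b')). a' + adjoint L b')"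

definition t_vec ::
  "('h::real_inner \<Rightarrow> 'g::real_inner) \<Rightarrow> ('h \<times> 'g) \<times> ('h \<times> 'g) \<Rightarrow> 'g" where
  "t_vec L = (\<lambda>((a, b), (a', b')). b - L a)"

definition tau ::
  "('h::real_inner \<Rightarrow> 'g::real_inner) \<Rightarrow> ('h \<times> 'g) \<times> ('h \<times> 'g) \<Rightarrow> real" where
  "tau L c = (norm (s_star L c))\<^sup>2 + (norm (t_vec L c))\<^sup>2"

definition theta ::
  "('h::real_inner \<Rightarrow> 'g::real_inner) \<Rightarrow> 'h \<times> 'g \<Rightarrow> ('h \<times> 'g) \<times> ('h \<times> 'g) \<Rightarrow> real \<Rightarrow> real" where
  "theta L = (\<lambda>(x, v) ((a, b), (a', b')) l.
     let c = ((a, b), (a', b')) in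
     if tau L c = 0 then 0
     else l * (x \<bullet> s_star L c + t_vec L c \<bullet> v - a \<bullet> a' - b \<bullet> b') / tau L c)"

definition half_point ::
  "('h::real_inner \<Rightarrow> 'g::real_inner) \<Rightarrow> 'h \<times> 'g \<Rightarrow> ('h \<times> 'g) \<times> ('h \<times> 'g) \<Rightarrow> real \<Rightarrow> 'h \<times> 'g" where
  "half_point L p c l =
     (fst p - theta L p c l *\<^sub>R s_star L c, snd p - theta L p c l *\<^sub>R t_vec L c)"

text \<open>
  In the following, \<open>p0\<close>, \<open>p\<close> and \<open>q\<close> are \<open>(x\<^sub>0, v\<^sub>0\<^sup>*)\<close>, \<open>(x\<^sub>n, v\<^sub>n\<^sup>*)\<close> and the half-step point.
  Inner products, norms and vector operations are those of the direct sum, so that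
  for instance \<open>chi\<close> is the sum of an inner product in each of the two spaces.
\<close>

definition chi :: "'k::real_inner \<Rightarrow> 'k \<Rightarrow> 'k \<Rightarrow> real" where
  "chi p0 p q = (p0 - p) \<bullet> (p - q)"

definition mu :: "'k::real_inner \<Rightarrow> 'k \<Rightarrow> real" where
  "mu p0 p = (norm (p0 - p))\<^sup>2"

definition nu :: "'k::real_inner \<Rightarrow> 'k \<Rightarrow> real" where
  "nu p q = (norm (p - q))\<^sup>2"

definition rho :: "'k::real_inner \<Rightarrow> 'k \<Rightarrow> 'k \<Rightarrow> real" where
  "rho p0 p q = mu p0 p * nu p q - (chi p0 p q)\<^sup>2"

definition case1 :: "'k::real_inner \<Rightarrow> 'k \<Rightarrow> 'k \<Rightarrow> bool" where
  "case1 p0 p q \<longleftrightarrow> rho p0 p q = 0 \<and> chi p0 p q \<ge> 0"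

definition case2 :: "'k::real_inner \<Rightarrow> 'k \<Rightarrow> 'k \<Rightarrow> bool" where
  "case2 p0 p q \<longleftrightarrow> rho p0 p q > 0 \<and> chi p0 p q * nu p q \<ge> rho p0 p q"

definition case3 :: "'k::real_inner \<Rightarrow> 'k \<Rightarrow> 'k \<Rightarrow> bool" where
  "case3 p0 p q \<longleftrightarrow> rho p0 p q > 0 \<and> chi p0 p q * nu p q < rho p0 p q"

definition valid_choice ::
  "('h::real_inner \<Rightarrow> 'h set) \<Rightarrow> ('g::real_inner \<Rightarrow> 'g set) \<Rightarrow> ('h \<Rightarrow> 'g) \<Rightarrow> real \<Rightarrow> real
     \<Rightarrow> 'h \<times> 'g \<Rightarrow> ('h \<times> 'g) \<times> ('h \<times> 'g) \<Rightarrow> real \<Rightarrow> bool" where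
  "valid_choice A B L \<epsilon> \<alpha> p c l \<longleftrightarrow>
     c \<in> G_set A B L \<alpha> p \<and> (tau L c > 0 \<longrightarrow> l \<in> {\<epsilon>..1})"

text \<open>
  \<open>update p0 p q p'\<close> fails for every \<open>p'\<close> if none of the three (mutually exclusive) cases applies.
\<close>

definition update :: "'k::real_inner \<Rightarrow> 'k \<Rightarrow> 'k \<Rightarrow> 'k \<Rightarrow> bool" where
  "update p0 p q p' \<longleftrightarrow>
     (case1 p0 p q \<and> p' = q) \<or>
     (case2 p0 p q \<and> p' = p0 + (1 + chi p0 p q / nu p q) *\<^sub>R (q - p)) \<or>
     (case3 p0 p q \<and>
        p' = p + (nu p q / rho p0 p q) *\<^sub>R (chi p0 p q *\<^sub>R (p0 - p) + mu p0 p *\<^sub>R (q - p)))"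

definition iteration ::
  "('h::real_inner \<Rightarrow> 'h set) \<Rightarrow> ('g::real_inner \<Rightarrow> 'g set) \<Rightarrow> ('h \<Rightarrow> 'g) \<Rightarrow> real \<Rightarrow> real
     \<Rightarrow> 'h \<times> 'g \<Rightarrow> 'h \<times> 'g \<Rightarrow> ('h \<times> 'g) \<times> ('h \<times> 'g) \<Rightarrow> real \<Rightarrow> 'h \<times> 'g \<Rightarrow> bool" where
  "iteration A B L \<epsilon> \<alpha> p0 p c l p' \<longleftrightarrow>
     valid_choice A B L \<epsilon> \<alpha> p c l \<and> update p0 p (half_point L p c l) p'"

end

theory Submission
  imports Defs
begin

text \<open>
  The Kuhn-Tucker set \<open>Z\<close> is an intersection of closed half-spaces, one for each pair of graph
  points: the bilinear terms in the monotonicity inequalities of \<open>A\<close> and \<open>B\<close> cancel when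
  the two are added. Each half-step cuts the current iterate off by a half-space containing \<open>Z\<close>,
  and the update is the projection of the starting point onto the intersection of two half-spaces
  containing \<open>Z\<close> (Haugazeau); hence the iterates stay at distance at most
  \<open>dist p\<^sub>0 Z\<close> from \<open>p\<^sub>0\<close>, and the squared steps telescope. For the strong
  convergence no weak compactness is needed: the closed convex hulls of the tails of the sequence
  have points of almost minimal distance to \<open>p\<^sub>0\<close> converging to a common point of all hulls.
  This point satisfies all the affine inequalities that define \<open>Z\<close>, which forces the distances
  of the iterates to \<open>p\<^sub>0\<close> to converge to \<open>dist p\<^sub>0 Z\<close>; the parallelogram
  law finishes the proof.
\<close>

section \<open>Nearest points in Hilbert spaces\<close>

lemma parallelogram_midpoint:
  fixes p y z :: "'a::real_inner"
  shows "(dist y z)\<^sup>2 = 2 * (dist p y)\<^sup>2 + 2 * (dist p z)\<^sup>2 - 4 * (dist p (midpoint y z))\<^sup>2"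
proof -
  have "p - midpoint y z = (1/2) *\<^sub>R ((p - y) + (p - z))"
    by (simp add: midpoint_def algebra_simps flip: scaleR_add_left)
  then have "4 * (dist p (midpoint y z))\<^sup>2 = (norm ((p - y) + (p - z)))\<^sup>2"
    by (simp add: dist_norm power_divide)
  moreover have "(dist y z)\<^sup>2 = (norm ((p - y) - (p - z)))\<^sup>2"
    by (simp add: dist_norm norm_minus_commute)
  ultimately show ?thesis
    by (simp add: dist_norm power2_norm_eq_inner inner_simps inner_commute)
qed

text \<open>The midpoint of two late terms lies in \<open>C N\<close>, hence at distance at least
  \<open>d N\<close> from \<open>p\<close>, while both endpoints have distance close to
  \<open>r\<close>; the parallelogram law then keeps the endpoints close together.\<close>

lemma asymptotically_nearest_Cauchy:
  fixes X :: "nat \<Rightarrow> 'a::real_inner"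
  assumes conv: "\<And>n. convex (C n)" and X: "\<And>m n. n \<le> m \<Longrightarrow> X m \<in> C n"
    and d: "\<And>n z. z \<in> C n \<Longrightarrow> d n \<le> dist p z" "\<And>n. 0 \<le> d n"
    and lim: "d \<longlonglongrightarrow> r" "(\<lambda>n. dist p (X n)) \<longlonglongrightarrow> r"
  shows "Cauchy X"
proof (rule metric_CauchyI)
  fix e :: real
  assume e: "0 < e"
  have "(\<lambda>n. (d n)\<^sup>2) \<longlonglongrightarrow> r\<^sup>2" "(\<lambda>n. (dist p (X n))\<^sup>2) \<longlonglongrightarrow> r\<^sup>2"
    using lim by (auto intro: tendsto_power)
  \<comment> \<open>The parallelogram law weights the two upper estimates by 2 each and the lower
    one by 4, so errors of \<open>e\<^sup>2 / 8\<close> add up to \<open>e\<^sup>2\<close>.\<close>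
  moreover have "r\<^sup>2 - e\<^sup>2 / 8 < r\<^sup>2" "r\<^sup>2 < r\<^sup>2 + e\<^sup>2 / 8"
    using e by auto
  ultimately have "\<forall>\<^sub>F n in sequentially. r\<^sup>2 - e\<^sup>2 / 8 < (d n)\<^sup>2 \<and> (dist p (X n))\<^sup>2 < r\<^sup>2 + e\<^sup>2 / 8"
    by (intro eventually_conj) (blast dest: order_tendstoD)+
  then obtain N where N: "r\<^sup>2 - e\<^sup>2 / 8 < (d n)\<^sup>2" "(dist p (X n))\<^sup>2 < r\<^sup>2 + e\<^sup>2 / 8" if "N \<le> n" for n
    by (auto simp: eventually_sequentially)
  have "dist (X m) (X n) < e" if "N \<le> m" "N \<le> n" for m n
  proof -
    have "closed_segment (X m) (X n) \<subseteq> C N"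
      using X that conv by (intro closed_segment_subset) auto
    then have "d N \<le> dist p (midpoint (X m) (X n))"
      using d(1) midpoint_in_closed_segment by blast
    then have "(d N)\<^sup>2 \<le> (dist p (midpoint (X m) (X n)))\<^sup>2"
      using d(2) by (simp add: power_mono)
    then have "(dist (X m) (X n))\<^sup>2 < e\<^sup>2"
      using N(2)[OF that(1)] N(2)[OF that(2)] N(1)[of N]
        parallelogram_midpoint[of "X m" "X n" p] by simp
    then show ?thesis
      using e by (simp add: power_less_imp_less_base)
  qed
  then show "\<exists>M. \<forall>m\<ge>M. \<forall>n\<ge>M. dist (X m) (X n) < e"
    by blast
qed

text \<open>Almost nearest points of the nested sets form a Cauchy sequence, and closedness puts its
  limit in every set. Constant sets yield nearest points; hulls of tails yield a common point that
  takes the place of a weak limit.\<close>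

lemma decseq_convex_near_points_converge:
  fixes C :: "nat \<Rightarrow> 'a::{real_inner, complete_space} set"
  assumes C: "\<And>n. convex (C n)" "\<And>n. closed (C n)" "\<And>n. C n \<noteq> {}" "decseq C"
    and lim: "(\<lambda>n. infdist p (C n)) \<longlonglongrightarrow> r"
  obtains q where "\<And>n. q \<in> C n" "dist p q = r"
proof -
  have "\<exists>z\<in>C n. dist p z < infdist p (C n) + 1 / Suc n" for n
    using cInf_lessD[of "dist p ` C n" "infdist p (C n) + 1 / Suc n"] C(3)
    by (auto simp: infdist_notempty)
  then obtain X where X: "X n \<in> C n" "dist p (X n) < infdist p (C n) + 1 / Suc n" for n
    by metis
  have XC: "X m \<in> C n" if "n \<le> m" for m n
    using X(1)[of m] C(4) that by (auto simp: decseq_def)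
  have ub: "(\<lambda>n. infdist p (C n) + 1 / Suc n) \<longlonglongrightarrow> r"
    using tendsto_add[OF lim LIMSEQ_Suc[OF lim_1_over_n]] by simp
  have D: "(\<lambda>n. dist p (X n)) \<longlonglongrightarrow> r"
    by (rule tendsto_sandwich[OF _ _ lim ub])
      (intro always_eventually allI infdist_le[OF X(1)] less_imp_le[OF X(2)])+
  have "Cauchy X"
    using C(1) XC infdist_le infdist_nonneg lim D by (rule asymptotically_nearest_Cauchy)
  then obtain q where q: "X \<longlonglongrightarrow> q"
    using Cauchy_convergent convergent_def by blast
  have "q \<in> C n" for n
    by (rule Lim_in_closed_set[OF C(2) _ _ q]) (auto simp: eventually_sequentially intro: XC)
  moreover have "dist p q = r"
    using tendsto_dist[OF tendsto_const q] D LIMSEQ_unique by blast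
  ultimately show thesis
    using that by blast
qed

lemma nearest_point_exists:
  fixes S :: "'a::{real_inner, complete_space} set"
  assumes "convex S" "closed S" "S \<noteq> {}"
  obtains q where "q \<in> S" "\<And>r. r \<in> S \<Longrightarrow> dist p q \<le> dist p r"
proof -
  obtain q where "q \<in> S" "dist p q = infdist p S"
    using assms decseq_convex_near_points_converge[of "\<lambda>_. S" p "infdist p S"]
    by (auto simp: decseq_def)
  then show thesis
    using that infdist_le by metis
qed

lemma nearest_point_unique:
  fixes S :: "'a::real_inner set"
  assumes "convex S" "q \<in> S" "q' \<in> S"
    and "\<And>r. r \<in> S \<Longrightarrow> dist p q \<le> dist p r" "dist p q' \<le> dist p q"
  shows "q' = q"
proof -
  have "midpoint q q' \<in> S"
    using assms(1-3) closed_segment_subset midpoint_in_closed_segment by blast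
  then have "(dist p q)\<^sup>2 \<le> (dist p (midpoint q q'))\<^sup>2" "(dist p q')\<^sup>2 \<le> (dist p q)\<^sup>2"
    using assms by (simp_all add: power_mono)
  then have "(dist q q')\<^sup>2 \<le> 0"
    unfolding parallelogram_midpoint[of q q' p] by linarith
  then show ?thesis by simp
qed

lemma projection_onto_nearest:
  fixes S :: "'a::{real_inner, complete_space} set"
  assumes "convex S" "closed S" "S \<noteq> {}"
  shows "projection_onto S p \<in> S" "r \<in> S \<Longrightarrow> dist p (projection_onto S p) \<le> dist p r"
proof -
  obtain q where q: "q \<in> S" "\<And>r. r \<in> S \<Longrightarrow> dist p q \<le> dist p r"
    using nearest_point_exists[OF assms] by blast
  have "projection_onto S p = q"
    unfolding projection_onto_def using q nearest_point_unique[OF assms(1)]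
    by (intro the_equality) blast+
  then show "projection_onto S p \<in> S" "r \<in> S \<Longrightarrow> dist p (projection_onto S p) \<le> dist p r"
    using q by auto
qed

text \<open>If the angle at \<open>q\<close> were acute, a short move from \<open>q\<close> towards
  \<open>y\<close>, which stays in \<open>S\<close>, would come closer to \<open>p\<close>.\<close>

lemma nearest_point_imp_inner_le:
  fixes S :: "'a::real_inner set"
  assumes "convex S" "q \<in> S" "\<And>r. r \<in> S \<Longrightarrow> dist p q \<le> dist p r" "y \<in> S"
  shows "(p - q) \<bullet> (y - q) \<le> 0"
proof (rule ccontr)
  assume "\<not> ?thesis"
  then obtain u where u: "0 < u" "u \<le> 1" "dist (q + u *\<^sub>R (y - q)) p < dist q p"
    using closer_point_lemma[of p q y] by (auto simp: dist_commute)
  have "q + u *\<^sub>R (y - q) \<in> S"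
    using convexD_alt[OF assms(1,2,4), of u] u by (simp add: algebra_simps)
  then show False
    using assms(3) u(3) by (fastforce simp: dist_commute)
qed

section \<open>Riesz representation and the adjoint of a bounded operator\<close>

text \<open>The point \<open>m\<close> of the hyperplane \<open>f = 1\<close> nearest to the origin
  is orthogonal to the kernel of \<open>f\<close>; rescaling \<open>m\<close> gives the representing
  vector.\<close>

lemma riesz_representation:
  fixes f :: "'a::{real_inner, complete_space} \<Rightarrow> real"
  assumes f: "bounded_linear f"
  obtains g where "\<And>x. f x = x \<bullet> g"
proof (cases "\<forall>x. f x = 0")
  case True
  then show thesis using that[of 0] by simp
next
  case False
  interpret bounded_linear f by fact
  let ?S = "f -` {1}"
  obtain z where "f z \<noteq> 0" using False by blast
  then have "(1 / f z) *\<^sub>R z \<in> ?S" by (simp add: scaleR)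
  then have ne: "?S \<noteq> {}" by blast
  have cl: "closed ?S"
    by (intro closed_vimage continuous_on) (auto intro: linear_continuous_on f)
  have cv: "convex ?S"
    by (simp add: convex_linear_vimage linear_axioms)
  obtain m where m: "m \<in> ?S" "\<And>r. r \<in> ?S \<Longrightarrow> dist 0 m \<le> dist 0 r"
    using nearest_point_exists[OF cv cl ne] by blast
  \<comment> \<open>Translating \<open>m\<close> by a kernel element stays in the hyperplane; using
    both \<open>x\<close> and \<open>- x\<close> turns the inequality into orthogonality.\<close>
  have orth: "m \<bullet> x \<ge> 0" if "f x = 0" for x
    using nearest_point_imp_inner_le[OF cv m, of "m + x"] m(1) that by (simp add: add)
  have orth': "m \<bullet> x = 0" if "f x = 0" for x
    using orth[OF that] orth[of "- x"] that by (simp add: neg)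
  have "f x = x \<bullet> ((1 / (m \<bullet> m)) *\<^sub>R m)" for x
  proof -
    have "m \<noteq> 0" using m(1) zero by auto
    moreover have "m \<bullet> (x - f x *\<^sub>R m) = 0"
      using m(1) by (intro orth') (simp add: diff scaleR)
    ultimately show ?thesis
      by (simp add: inner_diff_right inner_commute)
  qed
  then show thesis by (rule that)
qed

text \<open>\<open>adjoint\<close> is a choice operator, so its defining identity holds once some
  adjoint exists; Riesz representation supplies its value at each \<open>y\<close>.\<close>

lemma adjoint_bounded_linear:
  fixes L :: "'a::{real_inner, complete_space} \<Rightarrow> 'b::real_inner"
  assumes "bounded_linear L"
  shows "x \<bullet> adjoint L y = L x \<bullet> y"
proof -
  have "\<exists>g. \<forall>x. L x \<bullet> y = x \<bullet> g" for y
    using riesz_representation[OF bounded_linear_inner_left_comp[OF assms]] by metis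
  then have "\<exists>L'. \<forall>x y. L x \<bullet> y = x \<bullet> L' y"
    by metis
  then have "\<forall>x y. L x \<bullet> y = x \<bullet> adjoint L y"
    unfolding adjoint_def by (rule someI_ex)
  then show ?thesis by simp
qed

section \<open>Best approximation from an intersection of half-spaces\<close>

text \<open>Pairs of normal and offset are kept as data, so that a sequence can be tested against
  one inequality at a time.\<close>

definition halfspaces_inter :: "('a::real_inner \<times> real) set \<Rightarrow> 'a set" where
  "halfspaces_inter I = {z. \<forall>(g, c)\<in>I. g \<bullet> z \<le> c}"

lemma halfspaces_inter_alt: "halfspaces_inter I = (\<Inter>(g, c)\<in>I. {z. g \<bullet> z \<le> c})"
  by (auto simp: halfspaces_inter_def)

lemma convex_halfspaces_inter: "convex (halfspaces_inter I)"
  unfolding halfspaces_inter_alt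
  by (rule convex_INT) (auto simp: convex_halfspace_le)

lemma closed_halfspaces_inter: "closed (halfspaces_inter I)"
  unfolding halfspaces_inter_alt
  by (rule closed_INT) (auto simp: closed_halfspace_le)

text \<open>Each inequality is only required eventually and up to \<open>e\<close>, with no
  uniformity over \<open>I\<close>. This suffices because each is inherited by the closed convex
  hull of a tail.\<close>

lemma tendsto_projection_halfspaces_inter:
  fixes X :: "nat \<Rightarrow> 'a::{real_inner, complete_space}" and I :: "('a \<times> real) set"
  defines "S \<equiv> halfspaces_inter I"
  assumes ne: "S \<noteq> {}"
    and le: "\<And>n z. z \<in> S \<Longrightarrow> dist p (X n) \<le> dist p z"
    and ev: "\<And>g c e. (g, c) \<in> I \<Longrightarrow> 0 < e \<Longrightarrow> \<forall>\<^sub>F n in sequentially. g \<bullet> X n \<le> c + e"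
  shows "X \<longlonglongrightarrow> projection_onto S p"
proof -
  let ?q = "projection_onto S p"
  have cv: "convex S" and cl: "closed S"
    unfolding S_def by (rule convex_halfspaces_inter closed_halfspaces_inter)+
  note q = projection_onto_nearest[OF cv cl ne, where p = p]
  define C where "C n = closure (convex hull (X ` {n..}))" for n
  have C: "\<And>n. convex (C n)" "\<And>n. closed (C n)" "\<And>n. C n \<noteq> {}"
    by (auto simp: C_def convex_closure)
  have dec: "decseq C"
    unfolding decseq_def C_def by (intro allI impI closure_mono hull_mono image_mono) simp
  have XC: "X m \<in> C n" if "n \<le> m" for m n
    unfolding C_def using that by (intro subsetD[OF closure_subset] hull_inc) auto
  \<comment> \<open>A relaxed half-space is closed and convex, so it contains \<open>C N\<close> as
    soon as it contains the tail from \<open>N\<close> on; then \<open>e\<close> tends to 0.\<close>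
  have tail: "z \<in> S" if z: "\<And>n. z \<in> C n" for z
    unfolding S_def halfspaces_inter_def
  proof safe
    fix g c
    assume gc: "(g, c) \<in> I"
    show "g \<bullet> z \<le> c"
    proof (rule field_le_epsilon)
      fix e :: real
      assume "0 < e"
      then obtain N where N: "\<And>n. N \<le> n \<Longrightarrow> g \<bullet> X n \<le> c + e"
        using ev[OF gc] by (auto simp: eventually_sequentially)
      have "C N \<subseteq> {z. g \<bullet> z \<le> c + e}"
        unfolding C_def using N
        by (intro closure_minimal hull_minimal convex_halfspace_le closed_halfspace_le) auto
      then show "g \<bullet> z \<le> c + e"
        using z by force
    qed
  qed
  let ?d = "\<lambda>n. infdist p (C n)"
  have d_le: "?d n \<le> dist p (X n)" for n
    by (intro infdist_le XC) simp
  have "incseq ?d"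
    using dec C(3) by (auto simp: incseq_def decseq_def intro!: infdist_mono)
  moreover have "?d n \<le> dist p ?q" for n
    using d_le le[OF q(1)] order_trans by blast
  ultimately obtain r where r: "?d \<longlonglongrightarrow> r"
    using incseq_convergent by blast
  obtain z where z: "\<And>n. z \<in> C n" "dist p z = r"
    using decseq_convex_near_points_converge[OF C dec r] by blast
  have "r \<le> dist p ?q"
    using r \<open>\<And>n. ?d n \<le> dist p ?q\<close> LIMSEQ_le_const2 by blast
  \<comment> \<open>The common point \<open>z\<close> of the hulls lies in \<open>S\<close>, so its
    distance \<open>r\<close> cannot be below the minimum. Hence the distances of \<open>X n\<close>
    are squeezed between \<open>?d n\<close> and \<open>r\<close>.\<close>
  then have r_eq: "r = dist p ?q"
    using q(2)[OF tail, OF z(1)] z(2) by simp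
  have D: "(\<lambda>n. dist p (X n)) \<longlonglongrightarrow> r"
    by (rule tendsto_sandwich[OF _ _ r tendsto_const]) (simp_all add: d_le le[OF q(1)] r_eq)
  have "Cauchy X"
    using C(1) XC infdist_le infdist_nonneg r D by (rule asymptotically_nearest_Cauchy)
  then obtain y where y: "X \<longlonglongrightarrow> y"
    using Cauchy_convergent convergent_def by blast
  have "y \<in> C n" for n
    by (rule Lim_in_closed_set[OF C(2) _ _ y]) (auto simp: eventually_sequentially intro: XC)
  then have "y \<in> S" by (rule tail)
  moreover have "dist p y = r"
    using tendsto_dist[OF tendsto_const y] D LIMSEQ_unique by blast
  ultimately have "y = ?q"
    using nearest_point_unique[OF cv q(1) _ q(2)] r_eq by simp
  then show ?thesis using y by simp
qed

section \<open>Haugazeau's update\<close>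

text \<open>For \<open>p \<noteq> q\<close> this is the closed half-space whose nearest point to
  \<open>p\<close> is \<open>q\<close>; for \<open>p = q\<close> it is the whole space.\<close>

definition haugazeau_halfspace :: "'a::real_inner \<Rightarrow> 'a \<Rightarrow> 'a set" where
  "haugazeau_halfspace p q = {z. (z - q) \<bullet> (p - q) \<le> 0}"

text \<open>Pythagoras with a non-acute angle at \<open>q\<close>. The extra term
  \<open>(dist q z)\<^sup>2\<close> is what later makes the squared steps telescope.\<close>

lemma haugazeau_halfspace_dist:
  assumes "z \<in> haugazeau_halfspace p q"
  shows "(dist p q)\<^sup>2 + (dist q z)\<^sup>2 \<le> (dist p z)\<^sup>2"
proof -
  have "(dist p z)\<^sup>2 = (dist p q)\<^sup>2 + (dist q z)\<^sup>2 - 2 * ((z - q) \<bullet> (p - q))"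
    by (simp add: dist_norm power2_norm_eq_inner inner_simps inner_commute)
  then show ?thesis
    using assms by (simp add: haugazeau_halfspace_def)
qed

lemma haugazeau_halfspace_dist_le:
  assumes "z \<in> haugazeau_halfspace p q"
  shows "dist p q \<le> dist p z"
proof (rule power2_le_imp_le)
  show "(dist p q)\<^sup>2 \<le> (dist p z)\<^sup>2"
    using haugazeau_halfspace_dist[OF assms] zero_le_power2[of "dist q z"] by linarith
qed simp

text \<open>Both half-spaces are recentred at \<open>p\<close>, so that the update can be analysed
  through the Gram entries \<open>mu\<close>, \<open>chi\<close>, \<open>nu\<close> of
  \<open>p0 - p\<close> and \<open>p - q\<close>.\<close>

lemma haugazeau_halfspace_iff:
  "z \<in> haugazeau_halfspace p0 p \<longleftrightarrow> (z - p) \<bullet> (p0 - p) \<le> 0"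
  "z \<in> haugazeau_halfspace p q \<longleftrightarrow> (z - p) \<bullet> (p - q) \<le> - nu p q"
proof -
  have "(z - q) \<bullet> (p - q) = (z - p) \<bullet> (p - q) + nu p q"
    by (simp add: nu_def power2_norm_eq_inner inner_diff_left)
  then show "z \<in> haugazeau_halfspace p q \<longleftrightarrow> (z - p) \<bullet> (p - q) \<le> - nu p q"
    by (auto simp: haugazeau_halfspace_def)
qed (simp add: haugazeau_halfspace_def)

lemma rho_nonneg: "0 \<le> rho p0 p q"
  using Cauchy_Schwarz_ineq[of "p0 - p" "p - q"]
  by (simp add: rho_def mu_def nu_def chi_def power2_norm_eq_inner)

text \<open>\<open>rho\<close> is the Gram determinant of the two vectors, and the squared norm of
  the difference of the two sides is \<open>nu\<close> times \<open>rho\<close>.\<close>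

lemma rho_eq_0_collinear:
  assumes "rho p0 p q = 0"
  shows "nu p q *\<^sub>R (p0 - p) = chi p0 p q *\<^sub>R (p - q)"
proof -
  have "(norm (nu p q *\<^sub>R (p0 - p) - chi p0 p q *\<^sub>R (p - q)))\<^sup>2 = nu p q * rho p0 p q"
    unfolding rho_def mu_def nu_def chi_def power2_norm_eq_inner
    by (simp add: inner_diff_left inner_diff_right inner_commute power2_eq_square algebra_simps)
  then show ?thesis using assms by simp
qed

text \<open>The only uncovered situation is \<open>rho = 0\<close> with \<open>chi < 0\<close>: the
  two normals then point in opposite directions and the half-spaces are disjoint, contrary to
  \<open>z\<close>.\<close>

lemma haugazeau_cases:
  assumes "z \<in> haugazeau_halfspace p0 p" "z \<in> haugazeau_halfspace p q"
  shows "case1 p0 p q \<or> case2 p0 p q \<or> case3 p0 p q"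
proof -
  have "0 \<le> chi p0 p q" if "rho p0 p q = 0"
  proof (rule ccontr)
    assume neg: "\<not> ?thesis"
    have z: "(z - p) \<bullet> (p0 - p) \<le> 0" "(z - p) \<bullet> (p - q) \<le> - nu p q"
      using assms haugazeau_halfspace_iff by blast+
    have nu: "0 < nu p q"
      using neg by (auto simp: nu_def chi_def)
    have "nu p q * ((z - p) \<bullet> (p0 - p)) = chi p0 p q * ((z - p) \<bullet> (p - q))"
      using rho_eq_0_collinear[OF that] by (metis inner_scaleR_right)
    moreover have "nu p q * ((z - p) \<bullet> (p0 - p)) \<le> 0"
      using nu z(1) by (simp add: mult_nonneg_nonpos)
    moreover have "0 < chi p0 p q * ((z - p) \<bullet> (p - q))"
      using neg nu z(2) by (intro mult_neg_neg) auto
    ultimately show False by simp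
  qed
  then show ?thesis
    using rho_nonneg[of p0 p q] by (force simp: case1_def case2_def case3_def)
qed

lemma update_in_halfspaces:
  assumes "update p0 p q p'"
  shows "p' \<in> haugazeau_halfspace p0 p" "p' \<in> haugazeau_halfspace p q"
proof -
  let ?u = "p0 - p" and ?w = "p - q"
  let ?\<chi> = "chi p0 p q" and ?\<mu> = "mu p0 p" and ?\<nu> = "nu p q" and ?\<rho> = "rho p0 p q"
  have defs: "?u \<bullet> ?w = ?\<chi>" "?w \<bullet> ?u = ?\<chi>" "?u \<bullet> ?u = ?\<mu>" "?w \<bullet> ?w = ?\<nu>"
    by (simp_all add: chi_def mu_def nu_def power2_norm_eq_inner inner_commute)
  have rho: "?\<rho> = ?\<mu> * ?\<nu> - ?\<chi> * ?\<chi>"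
    by (simp add: rho_def power2_eq_square)
  have nu: "0 < ?\<nu>" if "0 < ?\<rho>"
    using that by (auto simp: rho_def nu_def chi_def)
  have "(p' - p) \<bullet> ?u \<le> 0 \<and> (p' - p) \<bullet> ?w \<le> - ?\<nu>"
    using assms unfolding update_def
  proof (elim disjE conjE)
    assume "case1 p0 p q" "p' = q"
    then have "p' - p = - ?w" "0 \<le> ?\<chi>"
      by (auto simp: case1_def)
    then show ?thesis
      by (simp only: inner_minus_left defs) simp
  next
    assume c: "case2 p0 p q" and "p' = p0 + (1 + ?\<chi> / ?\<nu>) *\<^sub>R (q - p)"
    then have e: "p' - p = ?u - (1 + ?\<chi> / ?\<nu>) *\<^sub>R ?w"
      by (simp add: algebra_simps)
    \<comment> \<open>The new point is on the boundary of the second half-space; the first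
      inequality becomes \<open>?\<rho> / ?\<nu> \<le> ?\<chi>\<close>, which is the case
      condition.\<close>
    have "0 < ?\<nu>" "?\<rho> \<le> ?\<chi> * ?\<nu>"
      using c nu by (auto simp: case2_def)
    then show ?thesis
      unfolding e inner_diff_left[of ?u] inner_scaleR_left defs rho
      by (simp add: field_simps)
  next
    assume c: "case3 p0 p q"
      and "p' = p + (?\<nu> / ?\<rho>) *\<^sub>R (?\<chi> *\<^sub>R (p0 - p) + ?\<mu> *\<^sub>R (q - p))"
    then have e: "p' - p = (?\<nu> / ?\<rho>) *\<^sub>R (?\<chi> *\<^sub>R ?u - ?\<mu> *\<^sub>R ?w)"
      by (simp add: algebra_simps)
    have "?\<rho> \<noteq> 0" using c by (simp add: case3_def)
    \<comment> \<open>Here both constraints are active: the inner product with \<open>?u\<close> is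
      0 and the one with \<open>?w\<close> is \<open>- ?\<nu>\<close>.\<close>
    then have "?\<nu> / ?\<rho> * (?\<chi> * ?\<chi> - ?\<mu> * ?\<nu>) = - ?\<nu>"
      using rho by (simp add: divide_simps) (simp add: algebra_simps)
    then show ?thesis
      unfolding e inner_scaleR_left inner_diff_left[of "?\<chi> *\<^sub>R ?u"] defs
      by (simp add: mult.commute)
  qed
  then show "p' \<in> haugazeau_halfspace p0 p" "p' \<in> haugazeau_halfspace p q"
    using haugazeau_halfspace_iff by blast+
qed

text \<open>Optimality conditions with multipliers: \<open>p0 - p'\<close> is a nonnegative
  combination of the normals \<open>?u\<close> and \<open>?w\<close>, and \<open>z - p'\<close> has
  nonpositive inner product with every normal that occurs.\<close>

lemma update_halfspace_supset:
  assumes "update p0 p q p'"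
    and "z \<in> haugazeau_halfspace p0 p" "z \<in> haugazeau_halfspace p q"
  shows "z \<in> haugazeau_halfspace p0 p'"
proof -
  let ?u = "p0 - p" and ?w = "p - q" and ?d = "z - p"
  let ?\<chi> = "chi p0 p q" and ?\<mu> = "mu p0 p" and ?\<nu> = "nu p q" and ?\<rho> = "rho p0 p q"
  have defs: "?u \<bullet> ?w = ?\<chi>" "?w \<bullet> ?u = ?\<chi>" "?u \<bullet> ?u = ?\<mu>" "?w \<bullet> ?w = ?\<nu>"
    by (simp_all add: chi_def mu_def nu_def power2_norm_eq_inner inner_commute)
  have rho: "?\<rho> = ?\<mu> * ?\<nu> - ?\<chi> * ?\<chi>"
    by (simp add: rho_def power2_eq_square)
  have nu: "0 < ?\<nu>" if "0 < ?\<rho>"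
    using that by (auto simp: rho_def nu_def chi_def)
  have z: "?d \<bullet> ?u \<le> 0" "?d \<bullet> ?w \<le> - ?\<nu>"
    using assms(2,3) haugazeau_halfspace_iff by blast+
  have "(z - p') \<bullet> (p0 - p') \<le> 0"
    using assms(1) unfolding update_def
  proof (elim disjE conjE)
    assume c: "case1 p0 p q" and "p' = q"
    then have e: "z - p' = ?d + ?w" "p0 - p' = ?u + ?w"
      by simp_all
    have "(?d + ?w) \<bullet> ?w \<le> 0"
      using z(2) unfolding inner_add_left defs by simp
    \<comment> \<open>By collinearity \<open>?u\<close> is a nonnegative multiple of
      \<open>?w\<close> unless \<open>?w = 0\<close>, so this follows from the previous
      inequality.\<close>
    moreover have "(?d + ?w) \<bullet> ?u \<le> 0"
    proof (cases "?\<nu> = 0")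
      case True
      then have "?w = 0" by (simp add: nu_def)
      then show ?thesis using z(1) by simp
    next
      case False
      then have "0 < ?\<nu>" by (simp add: nu_def)
      moreover have "?\<nu> * ((?d + ?w) \<bullet> ?u) = ?\<chi> * ((?d + ?w) \<bullet> ?w)"
        using c rho_eq_0_collinear[of p0 p q] by (metis case1_def inner_scaleR_right)
      moreover have "?\<chi> * ((?d + ?w) \<bullet> ?w) \<le> 0"
        using c \<open>(?d + ?w) \<bullet> ?w \<le> 0\<close> by (simp add: case1_def mult_nonneg_nonpos del: add_diff_cancel)
      ultimately show ?thesis
        by (metis mult_pos_pos not_le)
    qed
    ultimately show ?thesis
      unfolding e inner_add_right by linarith
  next
    assume c: "case2 p0 p q" and p': "p' = p0 + (1 + ?\<chi> / ?\<nu>) *\<^sub>R (q - p)"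
    then have e: "z - p' = ?d - (?u - (1 + ?\<chi> / ?\<nu>) *\<^sub>R ?w)" "p0 - p' = (1 + ?\<chi> / ?\<nu>) *\<^sub>R ?w"
      by (simp_all add: algebra_simps)
    have nu': "0 < ?\<nu>" and "0 < ?\<chi> * ?\<nu>"
      using c nu by (auto simp: case2_def)
    then have "0 < ?\<chi>" by (simp add: zero_less_mult_iff)
    have "(?d - (?u - (1 + ?\<chi> / ?\<nu>) *\<^sub>R ?w)) \<bullet> ?w = ?d \<bullet> ?w + ?\<nu>"
      unfolding inner_diff_left[of ?d] inner_diff_left[of ?u] inner_scaleR_left defs
      using nu' by (simp add: field_simps)
    then show ?thesis
      unfolding e inner_scaleR_right using z(2) nu' \<open>0 < ?\<chi>\<close>
      by (intro mult_nonneg_nonpos) auto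
  next
    assume c: "case3 p0 p q"
      and p': "p' = p + (?\<nu> / ?\<rho>) *\<^sub>R (?\<chi> *\<^sub>R (p0 - p) + ?\<mu> *\<^sub>R (q - p))"
    define e where "e = (?\<nu> / ?\<rho>) *\<^sub>R (?\<chi> *\<^sub>R ?u - ?\<mu> *\<^sub>R ?w)"
    have r: "0 < ?\<rho>" "?\<chi> * ?\<nu> < ?\<rho>" using c by (auto simp: case3_def)
    have e: "z - p' = ?d - e" "p0 - p' = (1 - ?\<nu> * ?\<chi> / ?\<rho>) *\<^sub>R ?u + (?\<nu> * ?\<mu> / ?\<rho>) *\<^sub>R ?w"
      unfolding p' e_def by (simp_all add: algebra_simps)
    have "e \<bullet> ?u = 0"
      unfolding e_def inner_scaleR_left inner_diff_left[of "?\<chi> *\<^sub>R ?u"] defs by simp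
    then have "(?d - e) \<bullet> ?u \<le> 0"
      using z(1) by (simp add: inner_diff_left[of ?d])
    moreover have "?\<nu> / ?\<rho> * (?\<chi> * ?\<chi> - ?\<mu> * ?\<nu>) = - ?\<nu>"
      using rho r by (simp add: divide_simps) (simp add: algebra_simps)
    then have "e \<bullet> ?w = - ?\<nu>"
      unfolding e_def inner_scaleR_left inner_diff_left[of "?\<chi> *\<^sub>R ?u"] defs .
    then have "(?d - e) \<bullet> ?w \<le> 0"
      using z(2) by (simp add: inner_diff_left[of ?d])
    \<comment> \<open>These are the two multipliers; the case condition makes the first one
      nonnegative.\<close>
    moreover have "0 \<le> 1 - ?\<nu> * ?\<chi> / ?\<rho>" "0 \<le> ?\<nu> * ?\<mu> / ?\<rho>"
      using r by (simp_all add: mult.commute nu_def mu_def)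
    ultimately show ?thesis
      unfolding e inner_add_right inner_scaleR_right
      by (intro add_nonpos_nonpos mult_nonneg_nonpos)
  qed
  then show ?thesis
    by (simp add: haugazeau_halfspace_def)
qed

section \<open>The Kuhn-Tucker set\<close>

text \<open>Together with \<open>cut_offset\<close> this describes the half-space cut out by
  \<open>c\<close>, which contains the Kuhn-Tucker set when \<open>c\<close> is in
  \<open>graph_points A B\<close>.\<close>

definition cut_normal ::
  "('h::real_inner \<Rightarrow> 'g::real_inner) \<Rightarrow> ('h \<times> 'g) \<times> ('h \<times> 'g) \<Rightarrow> 'h \<times> 'g" where
  "cut_normal L c = (s_star L c, t_vec L c)"

definition cut_offset :: "('h::real_inner \<times> 'g::real_inner) \<times> ('h \<times> 'g) \<Rightarrow> real" where
  "cut_offset c = fst c \<bullet> snd c"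

definition graph_points ::
  "('h \<Rightarrow> 'h set) \<Rightarrow> ('g \<Rightarrow> 'g set) \<Rightarrow> (('h \<times> 'g) \<times> ('h \<times> 'g)) set" where
  "graph_points A B = {((a, b), (a', b')). (a, a') \<in> gra A \<and> (b, b') \<in> gra B}"

lemma tau_eq: "tau L c = (norm (cut_normal L c))\<^sup>2"
  by (simp add: tau_def cut_normal_def norm_prod_def)

text \<open>The bilinear terms in \<open>x\<close> and \<open>v\<close> cancel by adjointness,
  leaving an affine function of \<open>(x, v)\<close>.\<close>

lemma cut_identity:
  assumes "\<And>x y. x \<bullet> adjoint L y = L x \<bullet> y"
  shows "(x - a) \<bullet> (a' + adjoint L v) + (L x - b) \<bullet> (b' - v)
    = cut_normal L ((a, b), (a', b')) \<bullet> (x, v) - cut_offset ((a, b), (a', b'))"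
  by (simp add: cut_normal_def cut_offset_def s_star_def t_vec_def inner_simps)
    (simp add: assms inner_commute)

text \<open>Separates the normal of the first pair of graph points, which tends to 0 along the
  iteration, from the affine function of a fixed second pair, for which weak convergence
  suffices.\<close>

lemma graph_cut_identity:
  assumes "\<And>x y. x \<bullet> adjoint L y = L x \<bullet> y"
  shows "(a - y) \<bullet> (a' - u) + (b - w) \<bullet> (b' - z)
    = ((a, b') - (y, z)) \<bullet> cut_normal L ((a, b), (a', b'))
      + (cut_offset ((y, w), (u, z)) - cut_normal L ((y, w), (u, z)) \<bullet> (a, b'))"
  by (simp add: cut_normal_def cut_offset_def s_star_def t_vec_def inner_simps)
    (simp add: assms inner_commute)

lemma graph_cut_self:
  assumes "\<And>x y. x \<bullet> adjoint L y = L x \<bullet> y"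
  shows "(a, b') \<bullet> cut_normal L ((a, b), (a', b')) = cut_offset ((a, b), (a', b'))"
  by (simp add: cut_normal_def cut_offset_def s_star_def t_vec_def inner_simps)
    (simp add: assms inner_commute)

lemma maximally_monotoneD:
  assumes "maximally_monotone A" "(a, a') \<in> gra A" "(b, b') \<in> gra A"
  shows "0 \<le> (a - b) \<bullet> (a' - b')"
  using assms by (auto simp: maximally_monotone_def monotone_operator_def)

text \<open>Otherwise inserting \<open>(x, u)\<close> would enlarge the graph and keep it
  monotone.\<close>

lemma maximally_monotone_related:
  assumes A: "maximally_monotone A"
    and rel: "\<And>a a'. (a, a') \<in> gra A \<Longrightarrow> 0 \<le> (x - a) \<bullet> (u - a')"
  shows "(x, u) \<in> gra A"
proof (rule ccontr)
  assume nin: "(x, u) \<notin> gra A"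
  define C where "C = A(x := insert u (A x))"
  have C: "gra C = insert (x, u) (gra A)"
    by (auto simp: C_def gra_def split: if_splits)
  have "0 \<le> (a - x) \<bullet> (a' - u)" if "(a, a') \<in> gra A" for a a'
    using rel[OF that] by (simp add: inner_diff_left inner_diff_right)
  then have "monotone_operator C"
    using rel maximally_monotoneD[OF A] by (auto simp: monotone_operator_def C)
  then show False
    using A nin C by (auto simp: maximally_monotone_def)
qed

text \<open>Adding the two monotonicity inequalities gives one inclusion. For the other, maximality
  must recover two memberships from the sum alone.\<close>

lemma kuhn_tucker_eq_halfspaces_inter:
  assumes A: "maximally_monotone A" and B: "maximally_monotone B"
    and adj: "\<And>x y. x \<bullet> adjoint L y = L x \<bullet> y"
  shows "kuhn_tucker A B L
    = halfspaces_inter ((\<lambda>c. (cut_normal L c, cut_offset c)) ` graph_points A B)"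
proof -
  have "(x, v) \<in> kuhn_tucker A B L \<longleftrightarrow>
      (\<forall>a a' b b'. (a, a') \<in> gra A \<longrightarrow> (b, b') \<in> gra B \<longrightarrow>
        0 \<le> (x - a) \<bullet> (- adjoint L v - a') + (L x - b) \<bullet> (v - b'))" (is "_ = ?rhs") for x v
  proof
    assume "(x, v) \<in> kuhn_tucker A B L"
    then have "(x, - adjoint L v) \<in> gra A" "(L x, v) \<in> gra B"
      by (auto simp: kuhn_tucker_def gra_def set_valued_inverse_def)
    then show ?rhs
      using maximally_monotoneD[OF A] maximally_monotoneD[OF B] by (blast intro: add_nonneg_nonneg)
  next
    assume rhs: ?rhs
    \<comment> \<open>A graph point of \<open>A\<close> with negative term would force the term of
      every graph point of \<open>B\<close> to be positive. Maximality of \<open>B\<close> then puts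
      \<open>(L x, v)\<close> in its graph, where that term is 0.\<close>
    have inA: "(x, - adjoint L v) \<in> gra A"
    proof (rule ccontr)
      assume notA: "(x, - adjoint L v) \<notin> gra A"
      then obtain a a' where a: "(a, a') \<in> gra A" "(x - a) \<bullet> (- adjoint L v - a') < 0"
        using maximally_monotone_related[OF A] not_le by blast
      have pos: "0 < (L x - b) \<bullet> (v - b')" if "(b, b') \<in> gra B" for b b'
        using rhs a that by fastforce
      then have "(L x, v) \<in> gra B"
        using maximally_monotone_related[OF B] less_imp_le by blast
      then show False
        using pos by force
    qed
    \<comment> \<open>Choosing \<open>(x, - adjoint L v)\<close> itself as the graph point of
      \<open>A\<close> removes the first term.\<close>
    have "0 \<le> (L x - b) \<bullet> (v - b')" if "(b, b') \<in> gra B" for b b'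
      using rhs inA that by fastforce
    then have "(L x, v) \<in> gra B"
      by (rule maximally_monotone_related[OF B])
    with inA show "(x, v) \<in> kuhn_tucker A B L"
      by (auto simp: kuhn_tucker_def gra_def set_valued_inverse_def)
  qed
  moreover have "(x - a) \<bullet> (- adjoint L v - a') + (L x - b) \<bullet> (v - b')
      = cut_offset ((a, b), (a', b')) - cut_normal L ((a, b), (a', b')) \<bullet> (x, v)" for x a b v a' b'
    using cut_identity[OF adj, of x a a' v b b'] by (simp add: inner_simps)
  ultimately show ?thesis
    by (force simp: halfspaces_inter_def graph_points_def)
qed

lemma kuhn_tucker_nonempty:
  assumes "\<exists>y. 0 \<in> A y + adjoint L ` B (L y)"
  shows "kuhn_tucker A B L \<noteq> {}"
proof -
  obtain y u w where "0 = u + adjoint L w" and u: "u \<in> A y" and w: "w \<in> B (L y)"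
    using assms by (auto simp: set_plus_def)
  then have "- adjoint L w = u"
    by (metis add_eq_0_iff2)
  with u w have "(y, w) \<in> kuhn_tucker A B L"
    by (simp add: kuhn_tucker_def set_valued_inverse_def)
  then show ?thesis by blast
qed

text \<open>For this choice the cut normal vanishes and both sides of the defining inequality are 0,
  so an admissible choice exists at every \<open>p\<close>.\<close>

lemma kuhn_tucker_in_G_set:
  assumes adj: "\<And>x y. x \<bullet> adjoint L y = L x \<bullet> y" and y: "(y, w) \<in> kuhn_tucker A B L"
  shows "((y, L y), (- adjoint L w, w)) \<in> G_set A B L \<alpha> p"
proof -
  obtain x v where "p = (x, v)" by fastforce
  with y show ?thesis
    by (auto simp: G_set_def kuhn_tucker_def gra_def set_valued_inverse_def inner_simps)
      (simp add: adj)
qed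

section \<open>The half-step as a relaxed projection onto a cut\<close>

lemma G_set_iff:
  assumes "\<And>x y. x \<bullet> adjoint L y = L x \<bullet> y"
  shows "c \<in> G_set A B L \<alpha> p \<longleftrightarrow>
    c \<in> graph_points A B \<and> \<alpha> * tau L c \<le> cut_normal L c \<bullet> p - cut_offset c"
  using cut_identity[OF assms]
  by (cases p; cases c)
    (auto simp: G_set_def graph_points_def tau_def s_star_def t_vec_def norm_minus_commute)

lemma half_point_eq: "half_point L p c l = p - theta L p c l *\<^sub>R cut_normal L c"
  by (simp add: half_point_def cut_normal_def prod_eq_iff)

lemma theta_eq:
  "theta L p c l = (if tau L c = 0 then 0 else l * (cut_normal L c \<bullet> p - cut_offset c) / tau L c)"
  by (cases p; cases c) (auto simp: theta_def Let_def cut_normal_def cut_offset_def inner_commute diff_diff_eq)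

text \<open>The half-step moves \<open>p\<close> towards the cut hyperplane without crossing it,
  since \<open>l \<le> 1\<close>, so its half-space still contains the cut and with it the
  Kuhn-Tucker set.\<close>

lemma kuhn_tucker_in_halfspace:
  assumes A: "maximally_monotone A" and B: "maximally_monotone B"
    and adj: "\<And>x y. x \<bullet> adjoint L y = L x \<bullet> y"
    and "0 \<le> \<epsilon>" "0 \<le> \<alpha>"
    and c: "valid_choice A B L \<epsilon> \<alpha> p c l"
    and z: "z \<in> kuhn_tucker A B L"
  shows "z \<in> haugazeau_halfspace p (half_point L p c l)"
proof (cases "tau L c = 0")
  case True
  then show ?thesis
    by (simp add: haugazeau_halfspace_def half_point_eq theta_eq)
next
  case False
  let ?\<sigma> = "cut_normal L c" and ?\<theta> = "theta L p c l"
  have tau: "0 < tau L c"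
    using False by (simp add: tau_eq)
  then have l: "0 \<le> l" "l \<le> 1" and cG: "c \<in> G_set A B L \<alpha> p"
    using c \<open>0 \<le> \<epsilon>\<close> by (auto simp: valid_choice_def)
  then have gp: "c \<in> graph_points A B"
    and "\<alpha> * tau L c \<le> ?\<sigma> \<bullet> p - cut_offset c"
    using G_set_iff[OF adj] by blast+
  then have G: "0 \<le> ?\<sigma> \<bullet> p - cut_offset c"
    using tau \<open>0 \<le> \<alpha>\<close> by (meson mult_nonneg_nonneg less_imp_le order_trans)
  then have theta: "0 \<le> ?\<theta>" "?\<theta> * tau L c = l * (?\<sigma> \<bullet> p - cut_offset c)"
    using False l tau by (auto simp: theta_eq)
  have "?\<sigma> \<bullet> z \<le> cut_offset c"
    using z gp unfolding kuhn_tucker_eq_halfspaces_inter[OF A B adj] halfspaces_inter_def by auto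
  moreover have "l * (?\<sigma> \<bullet> p - cut_offset c) \<le> 1 * (?\<sigma> \<bullet> p - cut_offset c)"
    using G l by (intro mult_right_mono)
  ultimately have "?\<sigma> \<bullet> z - ?\<sigma> \<bullet> p + ?\<theta> * tau L c \<le> 0"
    unfolding theta(2) by simp
  then have "?\<theta> * (?\<sigma> \<bullet> z - ?\<sigma> \<bullet> p + ?\<theta> * tau L c) \<le> 0"
    by (rule mult_nonneg_nonpos[OF theta(1)])
  also have "?\<theta> * (?\<sigma> \<bullet> z - ?\<sigma> \<bullet> p + ?\<theta> * tau L c)
      = (z - half_point L p c l) \<bullet> (p - half_point L p c l)"
    by (simp add: half_point_eq tau_eq power2_norm_eq_inner inner_simps inner_commute algebra_simps)
  finally show ?thesis
    by (simp add: haugazeau_halfspace_def)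
qed

text \<open>The violation of the cut at \<open>p\<close> is at least
  \<open>\<alpha> * tau L c\<close> and \<open>l\<close> is at least \<open>\<epsilon>\<close>, so
  the step factor is at least \<open>\<epsilon> * \<alpha>\<close>; \<open>nu\<close> is its square
  times \<open>tau\<close>.\<close>

lemma tau_le_nu_half_point:
  assumes adj: "\<And>x y. x \<bullet> adjoint L y = L x \<bullet> y"
    and "0 < \<epsilon>" "0 < \<alpha>" and c: "valid_choice A B L \<epsilon> \<alpha> p c l"
  shows "(\<epsilon> * \<alpha>)\<^sup>2 * tau L c \<le> nu p (half_point L p c l)"
proof (cases "tau L c = 0")
  case False
  then have tau: "0 < tau L c"
    by (simp add: tau_eq)
  have "\<epsilon> \<le> l" "\<alpha> * tau L c \<le> cut_normal L c \<bullet> p - cut_offset c"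
    using c tau G_set_iff[OF adj] by (auto simp: valid_choice_def)
  then have "\<epsilon> * (\<alpha> * tau L c) \<le> l * (cut_normal L c \<bullet> p - cut_offset c)"
    using assms(2,3) tau by (intro mult_mono) auto
  then have "\<epsilon> * \<alpha> \<le> theta L p c l"
    using tau by (simp add: theta_eq field_simps)
  then have "(\<epsilon> * \<alpha>)\<^sup>2 \<le> (theta L p c l)\<^sup>2"
    using assms(2,3) by (intro power_mono) auto
  then have "(\<epsilon> * \<alpha>)\<^sup>2 * tau L c \<le> (theta L p c l)\<^sup>2 * tau L c"
    using tau by (intro mult_right_mono) auto
  then show ?thesis
    by (simp add: nu_def half_point_eq tau_eq power_mult_distrib)
qed (simp add: nu_def)

section \<open>Well-posedness, summability and strong convergence of the iteration\<close>

theorem theorem3p3: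
  fixes A :: "'h::{real_inner, complete_space} \<Rightarrow> 'h set"
    and B :: "'g::{real_inner, complete_space} \<Rightarrow> 'g set"
    and L :: "'h \<Rightarrow> 'g"
    and x0 xbar :: 'h and v0 vbar :: 'g
    and \<epsilon> \<alpha> :: real
    and x a a' :: "nat \<Rightarrow> 'h" and v b b' :: "nat \<Rightarrow> 'g"
    and l :: "nat \<Rightarrow> real"
  assumes "maximally_monotone A" and "maximally_monotone B" and "bounded_linear L"
    and "\<exists>y. 0 \<in> A y + adjoint L ` B (L y)"
    and "(xbar, vbar) = projection_onto (kuhn_tucker A B L) (x0, v0)"
    and "0 < \<epsilon>" and "\<epsilon> < 1" and "0 < \<alpha>"
    and "x 0 = x0" and "v 0 = v0"
  shows
    "(\<forall>N.
        (\<forall>n<N. iteration A B L \<epsilon> \<alpha> (x0, v0) (x n, v n) ((a n, b n), (a' n, b' n)) (l n)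
                  (x (Suc n), v (Suc n))) \<longrightarrow>
        G_set A B L \<alpha> (x N, v N) \<noteq> {} \<and>
        (valid_choice A B L \<epsilon> \<alpha> (x N, v N) ((a N, b N), (a' N, b' N)) (l N) \<longrightarrow>
           (let q = half_point L (x N, v N) ((a N, b N), (a' N, b' N)) (l N) in
              case1 (x0, v0) (x N, v N) q \<or>
              case2 (x0, v0) (x N, v N) q \<or>
              case3 (x0, v0) (x N, v N) q)))
     \<and>
     ((\<forall>n. iteration A B L \<epsilon> \<alpha> (x0, v0) (x n, v n) ((a n, b n), (a' n, b' n)) (l n)
              (x (Suc n), v (Suc n))) \<longrightarrow>
        (summable (\<lambda>n. (norm (x (Suc n) - x n))\<^sup>2) \<and>
         summable (\<lambda>n. (norm (v (Suc n) - v n))\<^sup>2)) \<and>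
        (summable (\<lambda>n. (norm (s_star L ((a n, b n), (a' n, b' n))))\<^sup>2) \<and>
         summable (\<lambda>n. (norm (t_vec L ((a n, b n), (a' n, b' n))))\<^sup>2)) \<and>
        (weakly_converges (\<lambda>n. x n - a n) 0 \<and> weakly_converges (\<lambda>n. v n - b' n) 0 \<longrightarrow>
         x \<longlonglongrightarrow> xbar \<and> v \<longlonglongrightarrow> vbar))"
proof -
  define Z where "Z = kuhn_tucker A B L"
  define p where "p n = (x n, v n)" for n
  define c where "c n = ((a n, b n), (a' n, b' n))" for n
  have adj: "y \<bullet> adjoint L w = L y \<bullet> w" for y w
    using assms(3) by (rule adjoint_bounded_linear)
  note Z_eq = kuhn_tucker_eq_halfspaces_inter[OF assms(1,2) adj, folded Z_def]
  have Z_ne: "Z \<noteq> {}"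
    unfolding Z_def using assms(4) by (rule kuhn_tucker_nonempty)
  have p0: "p 0 = (x0, v0)"
    using assms by (simp add: p_def)
  have half: "z \<in> haugazeau_halfspace (p n) (half_point L (p n) (c n) (l n))"
    if "valid_choice A B L \<epsilon> \<alpha> (p n) (c n) (l n)" "z \<in> Z" for z n
    using that assms unfolding Z_def
    by (intro kuhn_tucker_in_halfspace[OF assms(1,2) adj]) auto
  \<comment> \<open>Invariant: \<open>Z\<close> lies in the half-space of \<open>p 0\<close> and
    \<open>p N\<close>. It starts as the whole space, and each update preserves the inclusion
    because the half-step half-space contains \<open>Z\<close> too.\<close>
  have inv: "z \<in> haugazeau_halfspace (p 0) (p N)"
    if "\<And>n. n < N \<Longrightarrow> iteration A B L \<epsilon> \<alpha> (p 0) (p n) (c n) (l n) (p (Suc n))" "z \<in> Z" for N z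
    using that
  proof (induction N)
    case 0
    then show ?case by (simp add: haugazeau_halfspace_def)
  next
    case (Suc N)
    then show ?case
      using update_halfspace_supset half by (simp add: iteration_def) blast
  qed
  have step_exists: "G_set A B L \<alpha> (p N) \<noteq> {} \<and>
      (valid_choice A B L \<epsilon> \<alpha> (p N) (c N) (l N) \<longrightarrow>
        (let q = half_point L (p N) (c N) (l N) in
          case1 (p 0) (p N) q \<or> case2 (p 0) (p N) q \<or> case3 (p 0) (p N) q))"
    if "\<forall>n<N. iteration A B L \<epsilon> \<alpha> (p 0) (p n) (c n) (l n) (p (Suc n))" for N
  proof -
    \<comment> \<open>One point of \<open>Z\<close> serves twice: as an admissible choice, and as
      the common point of the two half-spaces that guarantees one of the three cases.\<close>
    obtain z where z: "z \<in> Z"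
      using Z_ne by blast
    have "G_set A B L \<alpha> (p N) \<noteq> {}"
      using z kuhn_tucker_in_G_set[OF adj] unfolding Z_def by (cases z) blast
    then show ?thesis
      unfolding Let_def using haugazeau_cases inv half z that by blast
  qed
  have convergence: "summable (\<lambda>n. (norm (p (Suc n) - p n))\<^sup>2) \<and> summable (\<lambda>n. tau L (c n)) \<and>
      (weakly_converges (\<lambda>n. x n - a n) 0 \<and> weakly_converges (\<lambda>n. v n - b' n) 0 \<longrightarrow>
        p \<longlonglongrightarrow> projection_onto Z (p 0))"
    if it: "\<And>n. iteration A B L \<epsilon> \<alpha> (p 0) (p n) (c n) (l n) (p (Suc n))"
  proof -
    define q where "q n = half_point L (p n) (c n) (l n)" for n
    have valid: "valid_choice A B L \<epsilon> \<alpha> (p n) (c n) (l n)"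
      and upd: "update (p 0) (p n) (q n) (p (Suc n))" for n
      using it[of n] by (auto simp: iteration_def q_def)
    have le: "dist (p 0) (p n) \<le> dist (p 0) z" if "z \<in> Z" for n z
      using inv[OF it that] by (rule haugazeau_halfspace_dist_le)
    obtain z0 where z0: "z0 \<in> Z"
      using Z_ne by blast
    \<comment> \<open>\<open>p (Suc n)\<close> lies in the half-space of \<open>p 0\<close> and
      \<open>p n\<close>, so squared distances to \<open>p 0\<close> grow by at least the squared
      step; they are bounded by the distance to \<open>z0\<close>.\<close>
    have step: "(dist (p n) (p (Suc n)))\<^sup>2
        \<le> (dist (p 0) (p (Suc n)))\<^sup>2 - (dist (p 0) (p n))\<^sup>2" for n
      using haugazeau_halfspace_dist[OF update_in_halfspaces(1)[OF upd]] by (simp add: le_diff_eq add.commute)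
    have "(\<Sum>n<N. (dist (p n) (p (Suc n)))\<^sup>2) \<le> (dist (p 0) z0)\<^sup>2" for N
    proof -
      have "(\<Sum>n<N. (dist (p n) (p (Suc n)))\<^sup>2)
          \<le> (\<Sum>n<N. (dist (p 0) (p (Suc n)))\<^sup>2 - (dist (p 0) (p n))\<^sup>2)"
        using step by (rule sum_mono)
      also have "\<dots> = (dist (p 0) (p N))\<^sup>2"
        by (simp add: sum_lessThan_telescope[of "\<lambda>n. (dist (p 0) (p n))\<^sup>2"])
      also have "\<dots> \<le> (dist (p 0) z0)\<^sup>2"
        using le[OF z0] by (intro power_mono) auto
      finally show ?thesis .
    qed
    then have sum_step: "summable (\<lambda>n. (dist (p n) (p (Suc n)))\<^sup>2)"
      by (intro summableI_nonneg_bounded) auto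
    \<comment> \<open>\<open>p (Suc n)\<close> also lies in the half-space of \<open>p n\<close> and
      \<open>q n\<close>, so the full step is at least as long as the half-step.\<close>
    have "(\<epsilon> * \<alpha>)\<^sup>2 * tau L (c n) \<le> (dist (p n) (p (Suc n)))\<^sup>2" for n
    proof -
      have "(\<epsilon> * \<alpha>)\<^sup>2 * tau L (c n) \<le> nu (p n) (q n)"
        unfolding q_def using assms(6,8) valid by (intro tau_le_nu_half_point[OF adj])
      also have "\<dots> \<le> (dist (p n) (p (Suc n)))\<^sup>2"
        using haugazeau_halfspace_dist_le[OF update_in_halfspaces(2)[OF upd]]
        by (simp add: nu_def dist_norm power_mono)
      finally show ?thesis .
    qed
    then have "summable (\<lambda>n. (\<epsilon> * \<alpha>)\<^sup>2 * tau L (c n))"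
      by (intro summable_comparison_test'[OF sum_step]) (simp add: tau_eq)
    then have sum_tau: "summable (\<lambda>n. tau L (c n))"
      using assms(6,8) by (simp add: summable_cmult_iff)
    have "p \<longlonglongrightarrow> projection_onto Z (p 0)"
      if wx: "weakly_converges (\<lambda>n. x n - a n) 0" and wv: "weakly_converges (\<lambda>n. v n - b' n) 0"
      unfolding Z_eq
    proof (rule tendsto_projection_halfspaces_inter[OF Z_ne[unfolded Z_eq] le[unfolded Z_eq]])
      fix g r and e :: real
      assume "(g, r) \<in> (\<lambda>c. (cut_normal L c, cut_offset c)) ` graph_points A B" and e: "0 < e"
      then obtain y w u z where yu: "(y, u) \<in> gra A" and wz: "(w, z) \<in> gra B"
        and gr: "g = cut_normal L ((y, w), (u, z))" "r = cut_offset ((y, w), (u, z))"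
        by (auto simp: graph_points_def)
      let ?\<sigma> = "\<lambda>n. cut_normal L (c n)" and ?d = "\<lambda>n. p n - (a n, b' n)"
      have bound: "g \<bullet> p n \<le> r + ((p n - (y, z)) \<bullet> ?\<sigma> n + g \<bullet> ?d n)" for n
      proof -
        have cG: "c n \<in> graph_points A B" "\<alpha> * tau L (c n) \<le> ?\<sigma> n \<bullet> p n - cut_offset (c n)"
          using valid[of n] G_set_iff[OF adj] by (auto simp: valid_choice_def)
        \<comment> \<open>The choice of \<open>c n\<close> in \<open>G_set\<close> lets the bounded \<open>p n\<close> replace \<open>(a n, b' n)\<close>, so no
          boundedness of the latter (uniform boundedness principle) is required.\<close>
        have "0 \<le> \<alpha> * tau L (c n)"
          using assms(8) by (simp add: tau_eq)
        then have le_p: "(a n, b' n) \<bullet> ?\<sigma> n \<le> p n \<bullet> ?\<sigma> n"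
          using cG(2) graph_cut_self[OF adj, of "a n" "b' n" "b n" "a' n"]
          by (simp add: c_def inner_commute)
        \<comment> \<open>Monotonicity against the fixed graph points; in the resulting bound
          \<open>g \<bullet> (a n, b' n)\<close> is \<open>g \<bullet> p n\<close> minus
          \<open>g \<bullet> ?d n\<close>.\<close>
        have "0 \<le> (a n - y) \<bullet> (a' n - u) + (b n - w) \<bullet> (b' n - z)"
          using cG(1) maximally_monotoneD[OF assms(1) _ yu] maximally_monotoneD[OF assms(2) _ wz]
          by (auto simp: graph_points_def c_def intro: add_nonneg_nonneg)
        then have "0 \<le> ((a n, b' n) - (y, z)) \<bullet> ?\<sigma> n + (r - g \<bullet> (a n, b' n))"
          unfolding graph_cut_identity[OF adj] gr c_def .
        with le_p show ?thesis
          by (simp only: inner_diff_left inner_diff_right)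
      qed
      have "(\<lambda>n. sqrt (tau L (c n))) \<longlonglongrightarrow> sqrt 0"
        using summable_LIMSEQ_zero[OF sum_tau] by (rule tendsto_real_sqrt)
      then have "?\<sigma> \<longlonglongrightarrow> 0"
        by (simp add: tau_eq tendsto_norm_zero_iff)
      \<comment> \<open>The iterates stay in a ball around \<open>p 0\<close>, so pairing them with
        normals that tend to 0 in norm gives a null sequence.\<close>
      moreover have "Bfun (\<lambda>n. p n - (y, z)) sequentially"
      proof (rule BfunI, rule always_eventually, rule allI)
        fix n
        show "norm (p n - (y, z)) \<le> dist (p 0) z0 + dist (p 0) (y, z)"
          using le[OF z0, of n] dist_triangle[of "p n" "(y, z)" "p 0"]
          by (simp add: dist_norm dist_commute norm_minus_commute)
      qed
      ultimately have lim1: "(\<lambda>n. (p n - (y, z)) \<bullet> ?\<sigma> n) \<longlonglongrightarrow> 0"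
        using bounded_bilinear.Bfun_prod_Zfun[OF bounded_bilinear_inner]
        by (auto simp: tendsto_Zfun_iff)
      \<comment> \<open>Here \<open>g\<close> is fixed, so the assumed weak convergence in each
        factor is enough.\<close>
      have lim2: "(\<lambda>n. g \<bullet> ?d n) \<longlonglongrightarrow> 0"
      proof -
        have "(\<lambda>n. (x n - a n) \<bullet> fst g + (v n - b' n) \<bullet> snd g) \<longlonglongrightarrow> 0 \<bullet> fst g + 0 \<bullet> snd g"
          using wx wv by (intro tendsto_add) (auto simp: weakly_converges_def)
        then show ?thesis
          by (simp add: p_def inner_prod_def inner_commute)
      qed
      have "\<forall>\<^sub>F n in sequentially. (p n - (y, z)) \<bullet> ?\<sigma> n + g \<bullet> ?d n < e"
        using tendsto_add[OF lim1 lim2] e by (intro order_tendstoD(2)) auto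
      then show "\<forall>\<^sub>F n in sequentially. g \<bullet> p n \<le> r + e"
        by eventually_elim (use bound in \<open>smt (verit)\<close>)
    qed
    then show ?thesis
      using sum_step sum_tau by (simp add: dist_norm norm_minus_commute)
  qed
  have proj: "projection_onto Z (p 0) = (xbar, vbar)"
    using assms(5) by (simp add: Z_def p0)
  have limit: "x \<longlonglongrightarrow> xbar \<and> v \<longlonglongrightarrow> vbar" if "p \<longlonglongrightarrow> (xbar, vbar)"
    using tendsto_fst[OF that] tendsto_snd[OF that] by (simp add: p_def)
  have steps: "summable (\<lambda>n. (norm (x (Suc n) - x n))\<^sup>2) \<and> summable (\<lambda>n. (norm (v (Suc n) - v n))\<^sup>2)"
    if "summable (\<lambda>n. (norm (p (Suc n) - p n))\<^sup>2)"
    by (intro conjI; rule summable_comparison_test'[OF that]) (auto simp: p_def norm_prod_def)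
  have residuals: "summable (\<lambda>n. (norm (s_star L (c n)))\<^sup>2) \<and> summable (\<lambda>n. (norm (t_vec L (c n)))\<^sup>2)"
    if "summable (\<lambda>n. tau L (c n))"
    by (intro conjI; rule summable_comparison_test'[OF that]) (auto simp: tau_def)
  have conclusion: "(summable (\<lambda>n. (norm (x (Suc n) - x n))\<^sup>2) \<and>
         summable (\<lambda>n. (norm (v (Suc n) - v n))\<^sup>2)) \<and>
        (summable (\<lambda>n. (norm (s_star L (c n)))\<^sup>2) \<and> summable (\<lambda>n. (norm (t_vec L (c n)))\<^sup>2)) \<and>
        (weakly_converges (\<lambda>n. x n - a n) 0 \<and> weakly_converges (\<lambda>n. v n - b' n) 0 \<longrightarrow>
         x \<longlonglongrightarrow> xbar \<and> v \<longlonglongrightarrow> vbar)"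
    if "\<forall>n. iteration A B L \<epsilon> \<alpha> (p 0) (p n) (c n) (l n) (p (Suc n))"
    using convergence[OF that[rule_format]] steps residuals limit unfolding proj by auto
  show ?thesis
    unfolding p0[symmetric] p_def[symmetric] c_def[symmetric]
    by (rule conjI, intro allI, rule impI, erule step_exists, rule impI, erule conclusion)
qed

end
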